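(* Let $H$ be a real Hilbert space, let $\rho>0$, $L>0$, $\beta>0$, let $f,g:H\to(-\infty,+\infty]$ be proper, lower semicontinuous and $\rho$-strongly convex, and let $h:H\to\mathbb{R}$ be a smooth convex function whose gradient $\nabla h$ is Lipschitz continuous with constant $L$. Assume that the set $\Omega$ of stationary points of $f+g-h$ is nonempty, that $2\rho>L$, and that $(\kappa_n)_{n\ge 0}$ is a real sequence with $0<a\le\kappa_n\le b<2$ for all $n$, for some constants $a,b$. Let $(\alpha_n)_{n\ge 0}$ be a sequence in $[0,1)$ such that either there are constants $a',b'$ with $0<a'\le\alpha_n\le b'<1$ for all $n$, or $\alpha_n=0$ for all $n$. Let $x_0,v_0\in H$ be arbitrary and define, for $n\ge 0$, $$ \begin{aligned} u_n&=(1-\alpha_n)x_n+\alpha_n v_n,\\ y_n&=\operatorname*{argmin}_{v\in H}\Big\{f(v)+\frac{1}{2\beta}\|v-u_n\|^2\Big\},\\ z_n&=\operatorname*{argmin}_{v\in H}\Big\{g(v)+\frac{1}{2\beta}\|v-(2y_n-u_n+\beta\nabla h(y_n))\|^2\Big\},\\ x_{n+1}&=u_n+\kappa_n(z_n-y_n),\\ v_{n+1}&=(1-\alpha_n)v_n+\alpha_n x_n. \end{aligned} $$ Then the sequence $\{x_n\}$ converges weakly to a point in $\Gamma_\beta$.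
   Context: A function $f:H\to(-\infty,+\infty]$ is $\rho$-strongly convex if $f-\frac{\rho}{2}\|\cdot\|^2$ is convex. $\partial f$ denotes the convex subdifferential: $\partial f(x)=\{u\in H: f(z)\ge f(x)+\langle z-x,u\rangle\ \forall z\in H\}$. A point $x\in H$ is a stationary point of $p=f+g-h$ if $0\in\partial f(x)+\partial g(x)-\nabla h(x)$; $\Omega$ denotes the set of all stationary points. For $\beta>0$ and a proper, lower semicontinuous, convex function $f$, $\operatorname{prox}_{\beta f}(x)=\operatorname*{argmin}_{u\in H}\{f(u)+\frac{1}{2\beta}\|u-x\|^2\}$ (the unique minimizer). The set $\Gamma_\beta$ is $$\Gamma_\beta=\{y\in H:\ \text{there exists } x\in\Omega \text{ with } \operatorname{prox}_{\beta f}(y)=x \text{ and } \operatorname{prox}_{\beta g}(2x-y+\beta\nabla h(x))=x\}.$$ *)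

theory Defs
  imports "HOL-Analysis.Analysis"
begin

text \<open>
  Functions with values in \<open>(-\<infinity>, +\<infinity>]\<close> are rendered as \<open>ereal\<close>-valued functions that never
  take the value \<open>-\<infinity>\<close>; this requirement is part of \<open>proper\<close>.  A real Hilbert space is a type
  of class \<open>{real_inner, complete_space}\<close>.
\<close>

definition proper :: "('a \<Rightarrow> ereal) \<Rightarrow> bool" where
  "proper f \<longleftrightarrow> (\<forall>x. f x \<noteq> -\<infinity>) \<and> (\<exists>x. f x \<noteq> \<infinity>)"

definition lower_semicontinuous :: "('a::topological_space \<Rightarrow> ereal) \<Rightarrow> bool" where
  "lower_semicontinuous f \<longleftrightarrow> (\<forall>x. f x \<le> Liminf (nhds x) f)"

text \<open>
  Convexity on the whole space.  The weights are strictly positive, so no product \<open>0 * \<infinity>\<close> occurs;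
  the definition is intended for functions without the value \<open>-\<infinity>\<close>.
\<close>

definition convex_ereal :: "('a::real_vector \<Rightarrow> ereal) \<Rightarrow> bool" where
  "convex_ereal f \<longleftrightarrow>
    (\<forall>x y. \<forall>s>0. \<forall>t>0. s + t = 1 \<longrightarrow>
      f (s *\<^sub>R x + t *\<^sub>R y) \<le> ereal s * f x + ereal t * f y)"

definition strongly_convex :: "real \<Rightarrow> ('a::real_inner \<Rightarrow> ereal) \<Rightarrow> bool" where
  "strongly_convex \<rho> f \<longleftrightarrow> convex_ereal (\<lambda>x. f x - ereal (\<rho> / 2 * (norm x)\<^sup>2))"

definition subdifferential :: "('a::real_inner \<Rightarrow> ereal) \<Rightarrow> 'a \<Rightarrow> 'a set" where
  "subdifferential f x = {u. \<forall>z. f z \<ge> f x + ereal (inner (z - x) u)}"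

text \<open>\<open>prox \<beta> f x\<close> is the unique minimizer, and unspecified if there is none.\<close>

definition prox :: "real \<Rightarrow> ('a::real_inner \<Rightarrow> ereal) \<Rightarrow> 'a \<Rightarrow> 'a" where
  "prox \<beta> f x =
    (THE u. is_arg_min (\<lambda>w. f w + ereal (1 / (2 * \<beta>) * (norm (w - x))\<^sup>2)) (\<lambda>_. True) u)"

text \<open>In the next two definitions \<open>dh\<close> stands for the gradient of \<open>h\<close>.\<close>

definition stationary_points ::
  "('a::real_inner \<Rightarrow> ereal) \<Rightarrow> ('a \<Rightarrow> ereal) \<Rightarrow> ('a \<Rightarrow> 'a) \<Rightarrow> 'a set" where
  "stationary_points f g dh =
    {x. \<exists>s\<in>subdifferential f x. \<exists>t\<in>subdifferential g x. 0 = s + t - dh x}"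

definition Gamma_set ::
  "real \<Rightarrow> ('a::real_inner \<Rightarrow> ereal) \<Rightarrow> ('a \<Rightarrow> ereal) \<Rightarrow> ('a \<Rightarrow> 'a) \<Rightarrow> 'a set" where
  "Gamma_set \<beta> f g dh =
    {y. \<exists>x\<in>stationary_points f g dh.
      prox \<beta> f y = x \<and> prox \<beta> g (2 *\<^sub>R x - y + \<beta> *\<^sub>R dh x) = x}"

text \<open>Convergence in the weak topology, generated by the functionals \<open>\<lambda>x. inner x w\<close>.\<close>

definition weakly_converges :: "(nat \<Rightarrow> 'a::real_inner) \<Rightarrow> 'a \<Rightarrow> bool" where
  "weakly_converges x p \<longleftrightarrow> (\<forall>w. (\<lambda>n. inner (x n) w) \<longlonglongrightarrow> inner p w)"

end

theory Submission
  imports Defs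
begin

text \<open>
  Fix a stationary point \<open>q\<close> and let \<open>G\<close> be the set of all \<open>w\<close> whose two proximal steps both
  return \<open>q\<close>.  Strong monotonicity of the subdifferentials, with \<open>2 * \<rho> > L\<close> absorbing the term
  coming from the gradient, makes \<open>\<bar>x\<^sub>n - w\<bar>\<^sup>2 + \<bar>v\<^sub>n - w\<bar>\<^sup>2\<close> decrease for every \<open>w \<in> G\<close> by at least a
  multiple of \<open>\<bar>y\<^sub>n - q\<bar>\<^sup>2 + \<bar>z\<^sub>n - q\<bar>\<^sup>2 + \<alpha>\<^sub>n (1 - \<alpha>\<^sub>n) \<bar>v\<^sub>n - x\<^sub>n\<bar>\<^sup>2\<close>.  Hence \<open>y\<^sub>n\<close> and \<open>z\<^sub>n\<close>
  converge strongly to \<open>q\<close>, and \<open>\<langle>x\<^sub>n, w - w'\<rangle>\<close> converges for all \<open>w, w' \<in> G\<close>; an argument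
  of Opial type finishes the proof.  Weak compactness is replaced by the intersection of the
  closed convex hulls of the tails: the subgradient inequalities pass not only to weak cluster
  points of \<open>x\<^sub>n\<close> but to every point of that intersection, because each of them confines
  \<open>x\<^sub>n\<close> to a half-space.
\<close>

section \<open>Square-norm identities and nested convex sets\<close>

lemma norm_convex_combination:
  fixes x y :: "'a::real_inner"
  assumes "s + t = 1"
  shows "(norm (s *\<^sub>R x + t *\<^sub>R y))\<^sup>2 =
    s * (norm x)\<^sup>2 + t * (norm y)\<^sup>2 - s * t * (norm (x - y))\<^sup>2"
proof -
  have t: "t = 1 - s" using assms by simp
  show ?thesis
    unfolding t by (simp add: power2_norm_eq_inner algebra_simps inner_commute)
qed

lemma norm_add_scaleR_square:
  fixes x y :: "'a::real_inner"
  shows "(norm (x + t *\<^sub>R y))\<^sup>2 = (norm x)\<^sup>2 + 2 * t * inner x y + t\<^sup>2 * (norm y)\<^sup>2"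
  by (simp add: power2_norm_eq_inner inner_add_left inner_add_right inner_commute
      power2_eq_square[of t])

text \<open>Nearly norm-minimal points of the \<open>C n\<close> form a Cauchy sequence, by the parallelogram law.\<close>

lemma nested_closed_convex_Int_nonempty:
  fixes C :: "nat \<Rightarrow> 'a::{real_inner, complete_space} set"
  assumes closed: "\<And>n. closed (C n)" and convex: "\<And>n. convex (C n)"
    and ne: "\<And>n. C n \<noteq> {}" and dec: "decseq C" and bdd: "bounded (C 0)"
  shows "(\<Inter>n. C n) \<noteq> {}"
proof -
  \<comment> \<open>\<open>d n\<close> is the distance from the origin to \<open>C n\<close>. It
    increases because the sets shrink, and it stays below the bound for \<open>C 0\<close>.\<close>
  define d where "d n = Inf (norm ` C n)" for n
  have sub: "C n \<subseteq> C m" if "m \<le> n" for m n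
    using dec that by (simp add: decseqD)
  obtain B where B: "\<And>c. c \<in> C 0 \<Longrightarrow> norm c \<le> B"
    using bdd by (auto simp: bounded_iff)
  have bb: "bdd_below (norm ` C n)" for n
    by (rule bdd_belowI[of _ 0]) auto
  have d_le: "d n \<le> norm c" if "c \<in> C n" for c n
    unfolding d_def using that bb by (intro cInf_lower) auto
  have d_nonneg: "0 \<le> d n" for n
    unfolding d_def using ne by (intro cInf_greatest) auto
  have "d n \<le> B" for n
    using d_le[of _ n] B sub[of 0 n] ne[of n] by force
  moreover have "incseq d"
  proof (rule monoI)
    fix n m :: nat assume "n \<le> m"
    then show "d n \<le> d m"
      unfolding d_def using ne bb sub[of n m] by (intro cInf_superset_mono) auto
  qed
  ultimately obtain D where D: "d \<longlonglongrightarrow> D"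
    using incseq_convergent[of d B] by blast
  have "\<exists>c. c \<in> C n \<and> norm c < d n + 1 / real (Suc n)" for n
    using cInf_lessD[of "norm ` C n" "d n + 1 / real (Suc n)"] ne[of n]
    by (auto simp: d_def)
  then obtain c where c: "\<And>n. c n \<in> C n" "\<And>n. norm (c n) < d n + 1 / real (Suc n)"
    by metis
  have upper: "(\<lambda>n. d n + 1 / real (Suc n)) \<longlonglongrightarrow> D"
    using tendsto_add[OF D LIMSEQ_Suc[OF lim_1_over_n]] by simp
  have nc: "(\<lambda>n. norm (c n)) \<longlonglongrightarrow> D"
  proof (rule tendsto_sandwich[OF _ _ D upper])
    show "\<forall>\<^sub>F n in sequentially. d n \<le> norm (c n)"
      using d_le c(1) by (intro always_eventually) blast
    show "\<forall>\<^sub>F n in sequentially. norm (c n) \<le> d n + 1 / real (Suc n)"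
      using c(2) less_imp_le by (intro always_eventually) blast
  qed
  have "Cauchy c"
  proof (rule CauchyI')
    fix e :: real assume e: "0 < e"
    \<comment> \<open>The midpoint estimate below gives \<open>2 * (D\<^sup>2 + \<eta>) + 2 *
      (D\<^sup>2 + \<eta>) - 4 * (D\<^sup>2 - \<eta>) = 8 * \<eta>\<close> as a bound for the
      squared distance.\<close>
    define \<eta> where "\<eta> = e\<^sup>2 / 8"
    have "0 < \<eta>" using e by (simp add: \<eta>_def)
    have "\<forall>\<^sub>F n in sequentially. (norm (c n))\<^sup>2 < D\<^sup>2 + \<eta>"
      using order_tendstoD(2)[OF tendsto_power[OF nc, of 2]] \<open>0 < \<eta>\<close> by simp
    moreover have "\<forall>\<^sub>F n in sequentially. D\<^sup>2 - \<eta> < (d n)\<^sup>2"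
      using order_tendstoD(1)[OF tendsto_power[OF D, of 2]] \<open>0 < \<eta>\<close> by simp
    ultimately have "\<forall>\<^sub>F n in sequentially. (norm (c n))\<^sup>2 < D\<^sup>2 + \<eta> \<and> D\<^sup>2 - \<eta> < (d n)\<^sup>2"
      by (rule eventually_conj)
    then obtain M where M: "\<And>n. n \<ge> M \<Longrightarrow> (norm (c n))\<^sup>2 < D\<^sup>2 + \<eta>"
      "\<And>n. n \<ge> M \<Longrightarrow> D\<^sup>2 - \<eta> < (d n)\<^sup>2"
      unfolding eventually_sequentially by blast
    show "\<exists>M. \<forall>m\<ge>M. \<forall>n>m. dist (c m) (c n) < e"
      unfolding dist_norm
    proof (intro exI[of _ M] allI impI)
      fix m n assume mn: "M \<le> m" "m < n"
      \<comment> \<open>Both points lie in the larger set \<open>C m\<close>, so their midpoint has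
        norm at least \<open>d m\<close>.\<close>
      have "(1/2) *\<^sub>R c m + (1/2) *\<^sub>R c n \<in> C m"
        using c(1)[of m] c(1)[of n] sub[of m n] mn by (intro convexD[OF convex]) auto
      then have "(d m)\<^sup>2 \<le> (norm ((1/2) *\<^sub>R c m + (1/2) *\<^sub>R c n))\<^sup>2"
        using d_nonneg d_le by (intro power_mono)
      also have "\<dots> = ((norm (c m))\<^sup>2 + (norm (c n))\<^sup>2) / 2 - (norm (c m - c n))\<^sup>2 / 4"
        by (subst norm_convex_combination) (simp_all add: field_simps)
      finally have "(norm (c m - c n))\<^sup>2 < 8 * \<eta>"
        using M(1)[of m] M(1)[of n] M(2)[of m] mn by (simp add: field_simps)
      then show "norm (c m - c n) < e"
        using e power2_less_imp_less[of "norm (c m - c n)" e] by (simp add: \<eta>_def)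
    qed
  qed
  then obtain l where l: "c \<longlonglongrightarrow> l"
    using Cauchy_convergent convergent_def by blast
  have "l \<in> C n" for n
  proof (rule Lim_in_closed_set[OF closed _ _ l])
    show "\<forall>\<^sub>F k in sequentially. c k \<in> C n"
      using c(1) sub by (intro eventually_sequentiallyI[of n]) blast
  qed simp
  then show ?thesis by blast
qed

section \<open>Asymptotic hulls and a criterion for weak convergence\<close>

text \<open>By Hahn--Banach this is the intersection of the closed convex hulls of all tails of \<open>X\<close>.\<close>

definition asymptotic_hull :: "(nat \<Rightarrow> 'a::real_inner) \<Rightarrow> 'a set" where
  "asymptotic_hull X = {c. \<forall>w r. (\<forall>\<^sub>F n in sequentially. inner (X n) w \<le> r) \<longrightarrow> inner c w \<le> r}"

lemma asymptotic_hullD: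
  assumes "c \<in> asymptotic_hull X" "\<forall>\<^sub>F n in sequentially. inner (X n) w \<le> r"
  shows "inner c w \<le> r"
  using assms by (simp add: asymptotic_hull_def)

text \<open>The closed convex hulls of the tails are nested and bounded, so they share a point; a
  half-space containing a tail also contains its closed convex hull. This takes the place of weak
  sequential compactness.\<close>

lemma asymptotic_hull_nonempty:
  fixes X :: "nat \<Rightarrow> 'a::{real_inner, complete_space}"
  assumes "bounded (range X)"
  shows "asymptotic_hull X \<noteq> {}"
proof -
  define C where "C N = closure (convex hull (X ` {N..}))" for N
  have "bounded (C 0)"
    unfolding C_def using assms
    by (intro bounded_closure bounded_convex_hull) (auto intro: bounded_subset)
  moreover have "decseq C"
    unfolding C_def by (intro decseq_SucI closure_mono hull_mono) auto
  moreover have "C n \<noteq> {}" for n by (auto simp: C_def)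
  moreover have "closed (C n)" "convex (C n)" for n by (auto simp: C_def)
  ultimately have "(\<Inter>n. C n) \<noteq> {}"
    by (intro nested_closed_convex_Int_nonempty)
  then obtain c where c: "\<And>n. c \<in> C n" by auto
  have "c \<in> asymptotic_hull X"
    unfolding asymptotic_hull_def
  proof (intro CollectI allI impI)
    fix w r assume "\<forall>\<^sub>F n in sequentially. inner (X n) w \<le> r"
    then obtain N where N: "\<And>n. n \<ge> N \<Longrightarrow> inner w (X n) \<le> r"
      by (auto simp: eventually_sequentially inner_commute)
    have "C N \<subseteq> {c. inner w c \<le> r}"
      unfolding C_def using N
      by (intro closure_minimal hull_minimal closed_halfspace_le) (auto simp: convex_halfspace_le)
    with c show "inner c w \<le> r" by (auto simp: inner_commute)
  qed
  then show ?thesis by blast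
qed

text \<open>Convergence puts the tails into arbitrarily thin slabs around the level
  \<open>l\<close>; testing with \<open>w\<close> and \<open>- w\<close> confines \<open>c\<close>
  to each of them.\<close>

lemma asymptotic_hull_inner_eq:
  assumes "c \<in> asymptotic_hull X" "(\<lambda>n. inner (X n) w) \<longlonglongrightarrow> l"
  shows "inner c w = l"
proof -
  have "inner c w \<le> l + e" if "e > 0" for e
    using assms that
    by (intro asymptotic_hullD[OF assms(1)] eventually_mono[OF order_tendstoD(2)[OF assms(2), of "l+e"]]) auto
  moreover have "inner c (- w) \<le> - l + e" if "e > 0" for e
    using assms that
    by (intro asymptotic_hullD[OF assms(1)] eventually_mono[OF order_tendstoD(1)[OF assms(2), of "l-e"]]) auto
  ultimately show ?thesis
    by (intro antisym; rule_tac field_le_epsilon) (auto simp: algebra_simps)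
qed

text \<open>Moving \<open>\<mu>\<close> onto the test vector turns a half-space for a tail of
  \<open>Y\<close> into one for a tail of \<open>X\<close>, up to an arbitrarily small
  \<open>e\<close>. Both signs of \<open>\<mu>\<close> occur later.\<close>

lemma asymptotic_hull_affine:
  assumes c: "c \<in> asymptotic_hull X" and lim: "(\<lambda>n. Y n - \<mu> *\<^sub>R X n) \<longlonglongrightarrow> d"
  shows "\<mu> *\<^sub>R c + d \<in> asymptotic_hull Y"
  unfolding asymptotic_hull_def
proof (intro CollectI allI impI)
  fix w r assume ev: "\<forall>\<^sub>F n in sequentially. inner (Y n) w \<le> r"
  have lim': "(\<lambda>n. inner (Y n - \<mu> *\<^sub>R X n) w) \<longlonglongrightarrow> inner d w"
    by (intro tendsto_intros lim)
  have "inner c (\<mu> *\<^sub>R w) \<le> (r - inner d w) + e" if "e > 0" for e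
  proof (rule asymptotic_hullD[OF c])
    have "\<forall>\<^sub>F n in sequentially. inner d w - e < inner (Y n - \<mu> *\<^sub>R X n) w"
      using order_tendstoD(1)[OF lim'] that by auto
    with ev show "\<forall>\<^sub>F n in sequentially. inner (X n) (\<mu> *\<^sub>R w) \<le> r - inner d w + e"
      by eventually_elim (simp add: inner_diff_left)
  qed
  then have "inner c (\<mu> *\<^sub>R w) \<le> r - inner d w"
    by (rule field_le_epsilon) auto
  then show "inner (\<mu> *\<^sub>R c + d) w \<le> r" by (simp add: inner_add_left)
qed

text \<open>Opial's argument: if \<open>c\<close> and \<open>c'\<close> are hull points of the
  sequence and of a subsequence, the functional \<open>inner _ (c - c')\<close> takes the same limit
  value at both, so \<open>c = c'\<close>.\<close>

lemma weakly_converges_asymptotic_hull: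
  fixes X :: "nat \<Rightarrow> 'a::{real_inner, complete_space}"
  assumes bdd: "bounded (range X)"
    and hull: "\<And>r. strict_mono r \<Longrightarrow> asymptotic_hull (X \<circ> r) \<subseteq> G"
    and conv: "\<And>p q. p \<in> G \<Longrightarrow> q \<in> G \<Longrightarrow> convergent (\<lambda>n. inner (X n) (p - q))"
  shows "\<exists>p\<in>G. weakly_converges X p"
proof -
  obtain c where c: "c \<in> asymptotic_hull X"
    using asymptotic_hull_nonempty[OF bdd] by blast
  then have cG: "c \<in> G"
    using hull[of id] by (auto simp: strict_mono_id)
  \<comment> \<open>If this failed for some \<open>r\<close>, a subsequence would stay in the
    half-space \<open>r \<le> inner _ w\<close>, and so would its hull point, which must be
    \<open>c\<close>. Lower bounds follow by passing to \<open>- w\<close>.\<close>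
  have upper: "\<forall>\<^sub>F n in sequentially. inner (X n) w < r" if "inner c w < r" for w r
  proof (rule ccontr)
    assume "\<not> ?thesis"
    then have "infinite {n. r \<le> inner (X n) w}"
      by (auto simp: not_eventually frequently_sequentially infinite_nat_iff_unbounded_le not_less)
    then obtain s where s: "strict_mono (s :: nat \<Rightarrow> nat)" "\<And>n. r \<le> inner (X (s n)) w"
      using infinite_enumerate by blast
    have "bounded (range (X \<circ> s))"
      using bdd by (rule bounded_subset) auto
    then obtain c' where c': "c' \<in> asymptotic_hull (X \<circ> s)"
      using asymptotic_hull_nonempty by blast
    with hull[OF s(1)] have "c' \<in> G" by auto
    then obtain l where l: "(\<lambda>n. inner (X n) (c - c')) \<longlonglongrightarrow> l"
      using conv cG convergent_def by blast
    then have "inner c (c - c') = l" "inner c' (c - c') = l"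
      using asymptotic_hull_inner_eq[OF c l]
        asymptotic_hull_inner_eq[OF c', of "c - c'" l] LIMSEQ_subseq_LIMSEQ[OF l s(1)]
      by (auto simp: o_def)
    then have "inner (c - c') (c - c') = 0" by (simp add: inner_diff_left)
    then have "c' = c" by simp
    moreover have "inner c' (- w) \<le> - r"
      using s(2) by (intro asymptotic_hullD[OF c']) auto
    ultimately show False using that by simp
  qed
  have "(\<lambda>n. inner (X n) w) \<longlonglongrightarrow> inner c w" for w
    using upper[of w] upper[of "- w" "- r" for r] by (intro order_tendstoI) auto
  with cG show ?thesis by (auto simp: weakly_converges_def)
qed

section \<open>Strong convexity and subgradients\<close>

lemma le_of_le_add_small_multiple:
  fixes A B C :: real
  assumes "\<And>t. 0 < t \<Longrightarrow> t < 1 \<Longrightarrow> A \<le> C + t * B"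
  shows "A \<le> C"
proof (rule tendsto_lowerbound)
  have "((\<lambda>t. C + t * B) \<longlongrightarrow> C + 0 * B) (at_right 0)"
    by (intro tendsto_intros)
  then show "((\<lambda>t. C + t * B) \<longlongrightarrow> C) (at_right 0)" by simp
  show "\<forall>\<^sub>F t in at_right 0. A \<le> C + t * B"
    using assms by (intro eventually_at_rightI[of 0 1]) auto
qed simp

text \<open>Moving the quadratic term back across the convexity inequality leaves exactly the defect
  in \<open>norm_convex_combination\<close>.\<close>

lemma strongly_convexD:
  assumes sc: "strongly_convex \<rho> f" and fx: "f x = ereal p" and fy: "f y = ereal q"
    and st: "0 < s" "0 < t" "s + t = 1"
  shows "f (s *\<^sub>R x + t *\<^sub>R y) \<le> ereal (s * p + t * q - \<rho> / 2 * (s * t) * (norm (x - y))\<^sup>2)"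
proof -
  let ?w = "s *\<^sub>R x + t *\<^sub>R y"
  have "f ?w - ereal (\<rho> / 2 * (norm ?w)\<^sup>2) \<le>
      ereal s * (f x - ereal (\<rho> / 2 * (norm x)\<^sup>2)) + ereal t * (f y - ereal (\<rho> / 2 * (norm y)\<^sup>2))"
    using sc st unfolding strongly_convex_def convex_ereal_def by blast
  also have "\<dots> = ereal (s * (p - \<rho> / 2 * (norm x)\<^sup>2) + t * (q - \<rho> / 2 * (norm y)\<^sup>2))"
    by (simp add: fx fy)
  finally have "f ?w \<le> ereal (s * (p - \<rho> / 2 * (norm x)\<^sup>2) + t * (q - \<rho> / 2 * (norm y)\<^sup>2)
      + \<rho> / 2 * (norm ?w)\<^sup>2)"
    by (cases "f ?w") auto
  also have "s * (p - \<rho> / 2 * (norm x)\<^sup>2) + t * (q - \<rho> / 2 * (norm y)\<^sup>2) + \<rho> / 2 * (norm ?w)\<^sup>2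
      = s * p + t * q - \<rho> / 2 * (s * t) * (norm (x - y))\<^sup>2"
    unfolding norm_convex_combination[OF st(3)] by (simp add: algebra_simps)
  finally show ?thesis .
qed

lemma subdifferential_finite:
  assumes "proper f" "u \<in> subdifferential f x"
  obtains r where "f x = ereal r"
proof -
  obtain z where "f z \<noteq> \<infinity>" using assms(1) by (auto simp: proper_def)
  moreover have "f x + ereal (inner (z - x) u) \<le> f z"
    using assms(2) by (auto simp: subdifferential_def)
  moreover have "f x \<noteq> -\<infinity>" using assms(1) by (auto simp: proper_def)
  ultimately show ?thesis using that by (cases "f x") auto
qed

text \<open>The subgradient inequality is tested at a point of the segment from \<open>p\<close> to
  \<open>z\<close>, where strong convexity bounds \<open>f\<close> from above; dividing by
  \<open>t\<close> leaves an error of order \<open>t\<close>.\<close>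

lemma subdifferential_quadratic_growth:
  assumes sc: "strongly_convex \<rho> f" and u: "u \<in> subdifferential f p"
    and fp: "f p = ereal r" and fz: "f z = ereal b"
  shows "r + inner (z - p) u + \<rho> / 2 * (norm (z - p))\<^sup>2 \<le> b"
proof (rule le_of_le_add_small_multiple)
  fix t :: real assume t: "0 < t" "t < 1"
  let ?w = "(1 - t) *\<^sub>R p + t *\<^sub>R z"
  have "ereal (r + inner (?w - p) u) \<le> f ?w"
    using u fp by (auto simp: subdifferential_def)
  also have "\<dots> \<le> ereal ((1 - t) * r + t * b - \<rho> / 2 * ((1 - t) * t) * (norm (p - z))\<^sup>2)"
    using t by (intro strongly_convexD[OF sc fp fz]) auto
  finally have "r + inner (?w - p) u \<le>
      (1 - t) * r + t * b - \<rho> / 2 * ((1 - t) * t) * (norm (z - p))\<^sup>2"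
    by (simp add: norm_minus_commute)
  moreover have "inner (?w - p) u = t * inner (z - p) u"
    by (simp add: inner_diff_left algebra_simps)
  ultimately have "t * (r + inner (z - p) u + \<rho> / 2 * (norm (z - p))\<^sup>2) \<le>
      t * (b + t * (\<rho> / 2 * (norm (z - p))\<^sup>2))"
    by (simp add: algebra_simps diff_divide_distrib)
  then show "r + inner (z - p) u + \<rho> / 2 * (norm (z - p))\<^sup>2 \<le> b + t * (\<rho> / 2 * (norm (z - p))\<^sup>2)"
    using t by simp
qed

text \<open>The growth inequalities from \<open>p\<close> to \<open>q\<close> and from
  \<open>q\<close> to \<open>p\<close> are added, so the two halves of \<open>\<rho>\<close>
  combine.\<close>

lemma subdifferential_strongly_monotone:
  assumes sc: "strongly_convex \<rho> f" and proper: "proper f"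
    and u: "u \<in> subdifferential f p" and w: "w \<in> subdifferential f q"
  shows "\<rho> * (norm (p - q))\<^sup>2 \<le> inner (u - w) (p - q)"
proof -
  obtain r where r: "f p = ereal r" using subdifferential_finite[OF proper u] .
  obtain r' where r': "f q = ereal r'" using subdifferential_finite[OF proper w] .
  show ?thesis
    using subdifferential_quadratic_growth[OF sc u r r']
      subdifferential_quadratic_growth[OF sc w r' r]
    by (simp add: algebra_simps inner_commute norm_minus_commute)
qed

section \<open>Lower semicontinuity and existence of minimizers\<close>

lemma closed_sublevel_lower_semicontinuous:
  assumes "lower_semicontinuous F"
  shows "closed {w. F w \<le> c}"
proof -
  have "open {w. c < F w}"
  proof (subst open_subopen, intro ballI)
    fix w assume "w \<in> {w. c < F w}"
    then have "c < Liminf (nhds w) F"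
      using assms by (auto simp: lower_semicontinuous_def intro: less_le_trans)
    then have "\<forall>\<^sub>F w in nhds w. c < F w" by (rule less_LiminfD)
    then show "\<exists>T. open T \<and> w \<in> T \<and> T \<subseteq> {w. c < F w}"
      by (auto simp: eventually_nhds)
  qed
  moreover have "{w. F w \<le> c} = - {w. c < F w}" by auto
  ultimately show ?thesis by (simp add: closed_def)
qed

lemma lower_semicontinuous_add_continuous:
  assumes lsc: "lower_semicontinuous f" and ninf: "\<And>x. f x \<noteq> -\<infinity>"
    and cont: "continuous_on UNIV q"
  shows "lower_semicontinuous (\<lambda>x. f x + ereal (q x))"
  unfolding lower_semicontinuous_def le_Liminf_iff
proof (intro allI impI)
  fix x y assume y: "y < f x + ereal (q x)"
  show "\<forall>\<^sub>F w in nhds x. y < f w + ereal (q w)"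
  proof (cases y)
    case (real r)
    then have "ereal (r - q x) < f x" using y by (cases "f x") auto
    \<comment> \<open>The level \<open>r\<close> is split into \<open>c\<close> for \<open>f\<close>
      and \<open>r - c\<close> for \<open>q\<close>; each part is exceeded strictly at
      \<open>x\<close>, hence also nearby.\<close>
    then obtain c where c: "ereal (r - q x) < ereal c" "ereal c < f x"
      using ereal_dense2 by blast
    have "\<forall>\<^sub>F w in nhds x. ereal c < f w"
      using lsc c(2) by (intro less_LiminfD) (auto simp: lower_semicontinuous_def intro: less_le_trans)
    moreover have "\<forall>\<^sub>F w in nhds x. r - c < q w"
    proof (rule order_tendstoD(1))
      show "(q \<longlongrightarrow> q x) (nhds x)"
        using cont by (auto simp: continuous_on_def tendsto_at_iff_tendsto_nhds)
    qed (use c in simp)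
    ultimately show ?thesis
    proof eventually_elim
      case (elim w)
      then show ?case using real by (cases "f w") auto
    qed
  next
    case MInf
    then show ?thesis
      using ninf by (auto intro!: always_eventually simp: ereal_MInfty_lessI)
  qed (use y in auto)
qed

text \<open>The direct method: a common point of the sublevel sets along values tending to the
  infimum is a minimizer.\<close>

lemma ereal_minimum_attained:
  fixes F :: "'a::{real_inner, complete_space} \<Rightarrow> ereal"
  assumes proper: "proper F" and lsc: "lower_semicontinuous F"
    and conv: "\<And>r. convex {w. F w \<le> ereal r}" and bdd: "\<And>r. bounded {w. F w \<le> ereal r}"
  shows "\<exists>p. \<forall>w. F p \<le> F w"
proof -
  obtain w0 where w0: "F w0 \<noteq> \<infinity>" using proper by (auto simp: proper_def)
  obtain m where m: "decseq m" "range m \<subseteq> range F" "Inf (range F) = (INF i. m i)"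
    using Inf_countable_INF[of "range F"] by auto
  \<comment> \<open>The cap \<open>F w0\<close> keeps every level finite, even where
    \<open>m n\<close> is infinite, so that convexity and boundedness are available. Each level is a
    value of \<open>F\<close>, so no \<open>C n\<close> is empty.\<close>
  define C where "C n = {w. F w \<le> min (m n) (F w0)}" for n :: nat
  have real: "\<exists>r. C n = {w. F w \<le> ereal r}" for n
  proof -
    obtain w where "m n = F w" using m(2) by blast
    then have "min (m n) (F w0) \<noteq> \<infinity>" "min (m n) (F w0) \<noteq> -\<infinity>"
      using w0 proper by (auto simp: proper_def min_def)
    then show ?thesis unfolding C_def by (cases "min (m n) (F w0)") auto
  qed
  have "(\<Inter>n. C n) \<noteq> {}"
  proof (rule nested_closed_convex_Int_nonempty)
    show "closed (C n)" for n
      unfolding C_def by (rule closed_sublevel_lower_semicontinuous[OF lsc])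
    show "convex (C n)" for n using real[of n] conv by auto
    show "C n \<noteq> {}" for n
    proof -
      obtain w where "m n = F w" using m(2) by blast
      then have "w \<in> C n \<or> w0 \<in> C n" by (auto simp: C_def)
      then show ?thesis by blast
    qed
    show "decseq C"
      unfolding C_def
    proof (rule decseq_SucI, rule Collect_mono, rule impI)
      fix n w assume "F w \<le> min (m (Suc n)) (F w0)"
      then show "F w \<le> min (m n) (F w0)"
        using decseqD[OF m(1), of n "Suc n"] by auto
    qed
    show "bounded (C 0)" using real[of 0] bdd by auto
  qed
  then obtain p where p: "\<And>n. F p \<le> m n" by (auto simp: C_def)
  have "F p \<le> F w" for w
  proof -
    have "F p \<le> Inf (range F)" unfolding m(3) using p by (intro INF_greatest)
    also have "\<dots> \<le> F w" by (intro Inf_lower) auto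
    finally show ?thesis .
  qed
  then show ?thesis by blast
qed

section \<open>Proximal points and their subgradients\<close>

lemma prox_eqI:
  assumes \<beta>: "\<beta> > 0" and proper: "proper f" and sub: "(1 / \<beta>) *\<^sub>R (x - p) \<in> subdifferential f p"
  shows "prox \<beta> f x = p"
proof -
  define F where "F w = f w + ereal (1 / (2 * \<beta>) * (norm (w - x))\<^sup>2)" for w
  obtain r where r: "f p = ereal r" using subdifferential_finite[OF proper sub] .
  \<comment> \<open>Completing the square: the linear term of the subgradient inequality cancels the
    one in the expansion of the penalty around \<open>p\<close>. The remaining quadratic gap makes
    \<open>p\<close> the only minimizer.\<close>
  have growth: "F p + ereal (1 / (2 * \<beta>) * (norm (w - p))\<^sup>2) \<le> F w" for w
  proof -
    have "ereal (r + inner (w - p) ((1 / \<beta>) *\<^sub>R (x - p))) \<le> f w"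
      using sub r by (auto simp: subdifferential_def)
    moreover have "r + inner (w - p) ((1 / \<beta>) *\<^sub>R (x - p)) + 1 / (2 * \<beta>) * (norm (w - x))\<^sup>2
        = r + 1 / (2 * \<beta>) * (norm (p - x))\<^sup>2 + 1 / (2 * \<beta>) * (norm (w - p))\<^sup>2"
    proof -
      have "2 * inner (w - p) (x - p) + (norm (w - x))\<^sup>2 = (norm (p - x))\<^sup>2 + (norm (w - p))\<^sup>2"
        by (simp add: power2_norm_eq_inner algebra_simps inner_commute)
      moreover have "inner (w - p) ((1 / \<beta>) *\<^sub>R (x - p)) = inner (w - p) (x - p) / \<beta>"
        by simp
      ultimately show ?thesis using \<beta> by (simp add: field_simps del: inner_scaleR_right)
    qed
    ultimately show ?thesis
      unfolding F_def r by (cases "f w") auto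
  qed
  have "is_arg_min F (\<lambda>_. True) w \<longleftrightarrow> w = p" for w
  proof
    assume "is_arg_min F (\<lambda>_. True) w"
    then have "F w \<le> F p" by (auto simp: is_arg_min_linorder)
    with growth[of w] have "F p + ereal (1 / (2 * \<beta>) * (norm (w - p))\<^sup>2) \<le> F p"
      by (rule order_trans)
    then have "(norm (w - p))\<^sup>2 \<le> 0"
      using \<beta> by (auto simp: F_def r divide_le_0_iff)
    then show "w = p" by simp
  next
    assume "w = p"
    moreover have "F p \<le> F w" for w
    proof -
      have "F p \<le> F p + ereal (1 / (2 * \<beta>) * (norm (w - p))\<^sup>2)"
        using \<beta> by (auto simp: F_def r)
      also have "\<dots> \<le> F w" by (rule growth)
      finally show ?thesis .
    qed
    ultimately show "is_arg_min F (\<lambda>_. True) w" by (auto simp: is_arg_min_linorder)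
  qed
  then show ?thesis
    unfolding prox_def F_def[symmetric] by (intro the_equality) simp_all
qed

text \<open>
  The subgradient \<open>s\<close> provides an affine minorant of \<open>f\<close>, so that the regularized function has
  bounded sublevel sets.
\<close>

lemma prox_subgradient:
  fixes f :: "'a::{real_inner, complete_space} \<Rightarrow> ereal"
  assumes \<beta>: "\<beta> > 0" and \<rho>: "0 \<le> \<rho>"
    and proper: "proper f" and lsc: "lower_semicontinuous f" and sc: "strongly_convex \<rho> f"
    and s: "s \<in> subdifferential f q"
  shows "(1 / \<beta>) *\<^sub>R (x - prox \<beta> f x) \<in> subdifferential f (prox \<beta> f x)"
proof -
  define Q where "Q w = 1 / (2 * \<beta>) * (norm (w - x))\<^sup>2" for w
  define F where "F w = f w + ereal (Q w)" for w
  have ninf: "f w \<noteq> -\<infinity>" for w using proper by (auto simp: proper_def)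
  obtain fq where fq: "f q = ereal fq" using subdifferential_finite[OF proper s] .
  have convF: "f (a *\<^sub>R w + b *\<^sub>R w') \<le> ereal (a * r + b * r')"
    if "f w = ereal r" "f w' = ereal r'" "0 < a" "0 < b" "a + b = 1" for a b w w' r r'
  proof -
    have "f (a *\<^sub>R w + b *\<^sub>R w') \<le> ereal (a * r + b * r' - \<rho> / 2 * (a * b) * (norm (w - w'))\<^sup>2)"
      by (rule strongly_convexD[OF sc that])
    also have "\<dots> \<le> ereal (a * r + b * r')" using \<rho> that by simp
    finally show ?thesis .
  qed
  have "\<exists>p. \<forall>w. F p \<le> F w"
  proof (rule ereal_minimum_attained)
    show "proper F"
      using fq ninf unfolding proper_def F_def by (auto intro!: exI[of _ q])
    show "lower_semicontinuous F"
      unfolding F_def Q_def using lsc ninf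
      by (intro lower_semicontinuous_add_continuous continuous_intros) auto
    show "convex {w. F w \<le> ereal r}" for r
    proof (rule convexI)
      fix w w' :: 'a and a b :: real
      assume w: "w \<in> {w. F w \<le> ereal r}" "w' \<in> {w. F w \<le> ereal r}"
        and ab: "0 \<le> a" "0 \<le> b" "a + b = 1"
      show "a *\<^sub>R w + b *\<^sub>R w' \<in> {w. F w \<le> ereal r}"
      proof (cases "a = 0 \<or> b = 0")
        case True
        then show ?thesis using w ab by auto
      next
        case False
        then have pos: "0 < a" "0 < b" using ab by auto
        obtain c where c: "f w = ereal c" "c + Q w \<le> r"
          using w(1) ninf[of w] by (cases "f w") (auto simp: F_def)
        obtain c' where c': "f w' = ereal c'" "c' + Q w' \<le> r"
          using w(2) ninf[of w'] by (cases "f w'") (auto simp: F_def)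
        have "a *\<^sub>R w + b *\<^sub>R w' - x = a *\<^sub>R (w - x) + b *\<^sub>R (w' - x)"
          using ab(3) by (simp add: algebra_simps flip: scaleR_add_left)
        then have "(norm (a *\<^sub>R w + b *\<^sub>R w' - x))\<^sup>2 \<le> a * (norm (w - x))\<^sup>2 + b * (norm (w' - x))\<^sup>2"
          using norm_convex_combination[OF ab(3), of "w - x" "w' - x"] ab by simp
        from mult_left_mono[OF this, of "1 / (2 * \<beta>)"]
        have "Q (a *\<^sub>R w + b *\<^sub>R w') \<le> a * Q w + b * Q w'"
          using \<beta> by (simp add: Q_def distrib_left mult.left_commute)
        moreover have "a * (c + Q w) + b * (c' + Q w') \<le> a * r + b * r"
          using c c' ab by (intro add_mono mult_left_mono) auto
        moreover have "a * r + b * r = r"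
          using ab(3) by (simp flip: distrib_right)
        ultimately have "a * c + b * c' + Q (a *\<^sub>R w + b *\<^sub>R w') \<le> r"
          by (simp add: algebra_simps)
        moreover have "f (a *\<^sub>R w + b *\<^sub>R w') \<le> ereal (a * c + b * c')"
          using convF[OF c(1) c'(1) pos ab(3)] .
        ultimately show ?thesis
          unfolding F_def by (cases "f (a *\<^sub>R w + b *\<^sub>R w')") auto
      qed
    qed
    show "bounded {w. F w \<le> ereal r}" for r
    proof -
      \<comment> \<open>With the affine minorant, \<open>F w \<le> r\<close> becomes
        \<open>Q w \<le> K + t * norm s\<close>: a quadratic in \<open>t\<close> below an affine
        function.\<close>
      define K where "K = r - fq - inner (x - q) s"
      have "norm (w - x) \<le> max 1 (2 * \<beta> * (\<bar>K\<bar> + norm s))" if w: "F w \<le> ereal r" for w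
      proof (cases "norm (w - x) \<le> 1")
        case False
        define t where "t = norm (w - x)"
        have t: "1 < t" using False by (simp add: t_def)
        have "ereal (fq + inner (w - q) s) \<le> f w"
          using s fq by (auto simp: subdifferential_def)
        then have "fq + inner (w - q) s + Q w \<le> r"
          using w by (cases "f w") (auto simp: F_def)
        moreover have "inner (w - q) s = inner (w - x) s + inner (x - q) s"
          by (simp add: algebra_simps)
        moreover have "- inner (w - x) s \<le> t * norm s"
          unfolding t_def using norm_cauchy_schwarz[of "x - w" s]
          by (simp add: norm_minus_commute inner_diff_left)
        ultimately have "Q w \<le> K + t * norm s" by (simp add: K_def)
        \<comment> \<open>As \<open>t > 1\<close>, the constant is absorbed into a multiple of
          \<open>t\<close>, and one factor \<open>t\<close> can be cancelled.\<close>
        also have "\<dots> \<le> \<bar>K\<bar> * t + t * norm s"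
          using mult_left_mono[of 1 t "\<bar>K\<bar>"] t by linarith
        finally have "t * t \<le> t * (2 * \<beta> * (\<bar>K\<bar> + norm s))"
          using \<beta> by (simp add: Q_def t_def[symmetric] field_simps power2_eq_square)
        then show ?thesis using t by (simp add: t_def[symmetric])
      qed auto
      then have "{w. F w \<le> ereal r} \<subseteq> cball x (max 1 (2 * \<beta> * (\<bar>K\<bar> + norm s)))"
        by (auto simp: dist_norm norm_minus_commute)
      then show ?thesis by (rule bounded_subset[OF bounded_cball])
    qed
  qed
  then obtain p where p: "\<And>w. F p \<le> F w" by blast
  obtain r where r: "f p = ereal r"
    using p[of q] ninf[of p] fq by (cases "f p") (auto simp: F_def)
  \<comment> \<open>First-order optimality: \<open>p\<close> is compared with points of the segment
    to \<open>z\<close>, the inequality is divided by \<open>t\<close>, and \<open>t\<close> tends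
    to zero.\<close>
  have sub: "(1 / \<beta>) *\<^sub>R (x - p) \<in> subdifferential f p"
    unfolding subdifferential_def
  proof (intro CollectI allI)
    fix z
    show "f p + ereal (inner (z - p) ((1 / \<beta>) *\<^sub>R (x - p))) \<le> f z"
    proof (cases "f z")
      case (real b)
      define I where "I = inner (z - p) (x - p)"
      have "r + inner (z - p) ((1 / \<beta>) *\<^sub>R (x - p)) \<le> b"
      proof (rule le_of_le_add_small_multiple)
        fix t :: real assume t: "0 < t" "t < 1"
        let ?w = "(1 - t) *\<^sub>R p + t *\<^sub>R z"
        have "f ?w \<le> ereal ((1 - t) * r + t * b)"
          using t by (intro convF r real) auto
        with p[of ?w] have "r + Q p \<le> (1 - t) * r + t * b + Q ?w"
          using r by (cases "f ?w") (auto simp: F_def)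
        moreover have "Q ?w = Q p - (t / \<beta>) * I + t\<^sup>2 / (2 * \<beta>) * (norm (z - p))\<^sup>2"
        proof -
          have eq: "?w - x = (p - x) + t *\<^sub>R (z - p)" by (simp add: algebra_simps)
          have inner: "inner (p - x) (z - p) = - I"
            by (simp add: I_def inner_diff_left inner_diff_right inner_commute)
          have "(norm (?w - x))\<^sup>2 = (norm (p - x))\<^sup>2 - 2 * t * I + t\<^sup>2 * (norm (z - p))\<^sup>2"
            unfolding eq norm_add_scaleR_square by (simp add: inner)
          then show ?thesis using \<beta> by (simp add: Q_def field_simps)
        qed
        ultimately have "r + Q p \<le>
            (1 - t) * r + t * b + (Q p - (t / \<beta>) * I + t\<^sup>2 / (2 * \<beta>) * (norm (z - p))\<^sup>2)"
          by (simp only:)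
        then have "t * (r + I / \<beta>) \<le> t * (b + t * (1 / (2 * \<beta>) * (norm (z - p))\<^sup>2))"
          by (simp add: algebra_simps power2_eq_square[of t])
        then show "r + inner (z - p) ((1 / \<beta>) *\<^sub>R (x - p))
            \<le> b + t * (1 / (2 * \<beta>) * (norm (z - p))\<^sup>2)"
          using t by (simp add: I_def)
      qed
      then show ?thesis using r real by simp
    qed (use ninf in auto)
  qed
  with prox_eqI[OF \<beta> proper sub] show ?thesis by simp
qed

section \<open>Subgradients under strong limits of the base points\<close>

lemma subdifferential_asymptotic_hull:
  assumes proper: "proper f" and lsc: "lower_semicontinuous f"
    and p: "P \<longlonglongrightarrow> p" and s: "\<And>n. S n \<in> subdifferential f (P n)"
    and bdd: "bounded (range S)" and c: "c \<in> asymptotic_hull S"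
  shows "c \<in> subdifferential f p"
  unfolding subdifferential_def
proof (intro CollectI allI)
  fix t
  show "f p + ereal (inner (t - p) c) \<le> f t"
  proof (cases "f t")
    case (real b)
    obtain B where B: "\<And>n. norm (S n) \<le> B"
      using bdd by (auto simp: bounded_iff)
    have "(\<lambda>n. B * norm (p - P n)) \<longlonglongrightarrow> B * norm (p - p)"
      by (intro tendsto_intros p)
    then have lim: "(\<lambda>n. B * norm (p - P n)) \<longlonglongrightarrow> 0" by simp
    \<comment> \<open>Lower semicontinuity puts \<open>f (P n)\<close> above \<open>m\<close>
      eventually, so the subgradient inequality at \<open>t\<close> becomes a half-space condition
      on \<open>S n\<close>, which \<open>c\<close> inherits. Working with real \<open>m\<close>
      below \<open>f p\<close> avoids assuming that \<open>f p\<close> is finite.\<close>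
    have lower: "m \<le> b - inner (t - p) c" if m: "ereal m < f p" for m
    proof -
      have evm: "\<forall>\<^sub>F n in sequentially. ereal m < f (P n)"
      proof -
        have "\<forall>\<^sub>F w in nhds p. ereal m < f w"
          using lsc m by (intro less_LiminfD) (auto simp: lower_semicontinuous_def intro: less_le_trans)
        from eventually_compose_filterlim[OF this p] show ?thesis .
      qed
      have "inner c (t - p) \<le> (b - m) + e" if "e > 0" for e
      proof (rule asymptotic_hullD[OF c])
        have "\<forall>\<^sub>F n in sequentially. B * norm (p - P n) < e"
          using order_tendstoD(2)[OF lim that] .
        with evm show "\<forall>\<^sub>F n in sequentially. inner (S n) (t - p) \<le> b - m + e"
        proof eventually_elim
          case (elim n)
          have "f (P n) + ereal (inner (t - P n) (S n)) \<le> ereal b"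
            using s[of n] by (auto simp: subdifferential_def simp flip: real)
          then have "m + inner (t - P n) (S n) \<le> b"
            using elim(1) by (cases "f (P n)") auto
          moreover have "inner (S n) (t - p) = inner (t - P n) (S n) + inner (P n - p) (S n)"
            by (simp add: algebra_simps inner_commute)
          moreover have "inner (P n - p) (S n) \<le> B * norm (p - P n)"
            using norm_cauchy_schwarz[of "P n - p" "S n"]
              mult_right_mono[OF B[of n], of "norm (p - P n)"]
            by (simp add: norm_minus_commute mult.commute)
          ultimately show ?case using elim(2) by linarith
        qed
      qed
      then have "inner c (t - p) \<le> b - m" by (rule field_le_epsilon) auto
      then show ?thesis by (simp add: inner_commute)
    qed
    have "f p \<le> ereal (b - inner (t - p) c)"
    proof (rule dense_le)
      fix y assume "y < f p"
      then show "y \<le> ereal (b - inner (t - p) c)"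
        using lower by (cases y) auto
    qed
    then show ?thesis using real by (cases "f p") auto
  qed (use proper in \<open>auto simp: proper_def\<close>)
qed

section \<open>Estimates for one step of the iteration\<close>

text \<open>
  Here \<open>U\<close>, \<open>p\<close>, \<open>q\<close> and \<open>D\<close> stand for the differences of \<open>u\<^sub>n\<close>, \<open>y\<^sub>n\<close>, \<open>z\<^sub>n\<close> and \<open>dh y\<^sub>n\<close> from
  their values at a fixed point.
\<close>

lemma operator_coercive:
  fixes p q U D :: "'a::real_inner"
  assumes \<beta>: "\<beta> > 0" and L: "0 \<le> L"
    and f: "\<beta> * \<rho> * (norm p)\<^sup>2 \<le> inner (U - p) p"
    and g: "\<beta> * \<rho> * (norm q)\<^sup>2 \<le> inner (2 *\<^sub>R p - U + \<beta> *\<^sub>R D - q) q"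
    and D: "norm D \<le> L * norm p"
  shows "(norm (q - p))\<^sup>2 + \<beta> * (\<rho> - L / 2) * ((norm p)\<^sup>2 + (norm q)\<^sup>2) \<le> - inner U (q - p)"
proof -
  have "inner D q \<le> norm D * norm q" by (rule norm_cauchy_schwarz)
  also have "\<dots> \<le> L * (norm p * norm q)"
    using mult_right_mono[OF D, of "norm q"] by (simp add: mult.assoc)
  \<comment> \<open>Splitting the product evenly costs each of the two strong monotonicity terms
    only \<open>\<beta> * L / 2\<close>.\<close>
  also have "\<dots> \<le> L * (((norm p)\<^sup>2 + (norm q)\<^sup>2) / 2)"
    using L sum_squares_bound[of "norm p" "norm q"] by (intro mult_left_mono) auto
  finally have "\<beta> * inner D q \<le> \<beta> * (L * (((norm p)\<^sup>2 + (norm q)\<^sup>2) / 2))"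
    using \<beta> by (intro mult_left_mono) auto
  moreover have "inner (U - p) p + inner (2 *\<^sub>R p - U + \<beta> *\<^sub>R D - q) q
      = - inner U (q - p) - (norm (q - p))\<^sup>2 + \<beta> * inner D q"
    by (simp add: power2_norm_eq_inner algebra_simps inner_commute)
  ultimately show ?thesis using f g by (simp add: algebra_simps)
qed

text \<open>In the expanded square, \<open>\<kappa> \<le> 2\<close> lets the coercive term
  \<open>2 * \<kappa> * (norm (q - p))\<^sup>2\<close> absorb the quadratic one; the part with
  \<open>\<delta>\<close> survives as the decrease.\<close>

lemma relaxed_step_decrease:
  fixes p q U :: "'a::real_inner"
  assumes coercive: "(norm (q - p))\<^sup>2 + \<delta> * ((norm p)\<^sup>2 + (norm q)\<^sup>2) \<le> - inner U (q - p)"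
    and \<delta>: "0 \<le> \<delta>" and \<kappa>: "0 \<le> a" "a \<le> \<kappa>" "\<kappa> \<le> 2"
  shows "(norm (U + \<kappa> *\<^sub>R (q - p)))\<^sup>2 + 2 * a * \<delta> * ((norm p)\<^sup>2 + (norm q)\<^sup>2) \<le> (norm U)\<^sup>2"
proof -
  define E where "E = (norm p)\<^sup>2 + (norm q)\<^sup>2"
  have "(norm (U + \<kappa> *\<^sub>R (q - p)))\<^sup>2 = (norm U)\<^sup>2 + 2 * \<kappa> * inner U (q - p) + \<kappa>\<^sup>2 * (norm (q - p))\<^sup>2"
    by (rule norm_add_scaleR_square)
  moreover have "2 * \<kappa> * ((norm (q - p))\<^sup>2 + \<delta> * E) \<le> 2 * \<kappa> * (- inner U (q - p))"
    using coercive \<kappa> unfolding E_def by (intro mult_left_mono) auto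
  moreover have "\<kappa>\<^sup>2 * (norm (q - p))\<^sup>2 \<le> 2 * \<kappa> * (norm (q - p))\<^sup>2"
    using \<kappa> by (intro mult_right_mono) (auto simp: power2_eq_square intro: mult_right_mono)
  moreover have "2 * a * (\<delta> * E) \<le> 2 * \<kappa> * (\<delta> * E)"
    using \<kappa> \<delta> by (intro mult_right_mono) (auto simp: E_def)
  ultimately show ?thesis unfolding E_def[symmetric] by (simp add: algebra_simps)
qed

text \<open>The subgradients in the iteration are multiples of the iterates up to a convergent
  error, so hull points of the iterates yield hull points of the subgradients.\<close>

lemma subdifferential_affine_hull_limit:
  assumes proper: "proper f" and lsc: "lower_semicontinuous f"
    and P: "P \<longlonglongrightarrow> p" and S: "\<And>n. S n \<in> subdifferential f (P n)"
    and bdd: "bounded (range X)" and c: "c \<in> asymptotic_hull X"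
    and lim: "(\<lambda>n. S n - \<mu> *\<^sub>R X n) \<longlonglongrightarrow> d"
  shows "\<mu> *\<^sub>R c + d \<in> subdifferential f p"
proof (rule subdifferential_asymptotic_hull[OF proper lsc P S])
  have "bounded (range (\<lambda>n. S n - \<mu> *\<^sub>R X n))"
    using lim convergent_def convergent_imp_bounded by blast
  moreover have "bounded (range (\<lambda>n. \<mu> *\<^sub>R X n))"
    using bounded_scaling[OF bdd, of \<mu>] by (simp add: image_image)
  ultimately have "bounded (range (\<lambda>n. (S n - \<mu> *\<^sub>R X n) + \<mu> *\<^sub>R X n))"
    by (rule bounded_plus_comp)
  then show "bounded (range S)" by simp
  show "\<mu> *\<^sub>R c + d \<in> asymptotic_hull S"
    by (rule asymptotic_hull_affine[OF c lim])
qed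

lemma tendsto_zero_of_square_le:
  fixes Y :: "nat \<Rightarrow> 'a::real_normed_vector" and d :: "nat \<Rightarrow> real"
  assumes "0 < K" and le: "\<And>n. K * (norm (Y n))\<^sup>2 \<le> d n" and d: "d \<longlonglongrightarrow> 0"
  shows "Y \<longlonglongrightarrow> 0"
proof (rule Lim_null_comparison)
  show "\<forall>\<^sub>F n in sequentially. norm (Y n) \<le> sqrt (d n / K)"
    using le \<open>0 < K\<close>
    by (intro always_eventually allI real_le_rsqrt) (simp add: field_simps)
  have "(\<lambda>n. sqrt (d n / K)) \<longlonglongrightarrow> sqrt (0 / K)"
    using \<open>0 < K\<close> by (intro tendsto_intros d) auto
  then show "(\<lambda>n. sqrt (d n / K)) \<longlonglongrightarrow> 0" by simp
qed

section \<open>Weak convergence of the iterates\<close>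

theorem theorem3p5:
  fixes f g :: "'a::{real_inner, complete_space} \<Rightarrow> ereal"
    and h :: "'a \<Rightarrow> real" and dh :: "'a \<Rightarrow> 'a"
    and \<rho> L \<beta> a b :: real
    and \<kappa> \<alpha> :: "nat \<Rightarrow> real"
    and x v u y z :: "nat \<Rightarrow> 'a"
  assumes "\<rho> > 0" and "L > 0" and "\<beta> > 0"
    and "proper f" and "lower_semicontinuous f" and "strongly_convex \<rho> f"
    and "proper g" and "lower_semicontinuous g" and "strongly_convex \<rho> g"
    and "convex_on UNIV h"
    and "\<And>p. GDERIV h p :> dh p"
    and "L-lipschitz_on UNIV dh"
    and "stationary_points f g dh \<noteq> {}"
    and "2 * \<rho> > L"
    and "0 < a" and "b < 2" and "\<And>n. a \<le> \<kappa> n \<and> \<kappa> n \<le> b"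
    and "\<And>n. 0 \<le> \<alpha> n \<and> \<alpha> n < 1"
    and "(\<exists>a' b'. 0 < a' \<and> b' < 1 \<and> (\<forall>n. a' \<le> \<alpha> n \<and> \<alpha> n \<le> b')) \<or> (\<forall>n. \<alpha> n = 0)"
    and "\<And>n. u n = (1 - \<alpha> n) *\<^sub>R x n + \<alpha> n *\<^sub>R v n"
    and "\<And>n. y n = prox \<beta> f (u n)"
    and "\<And>n. z n = prox \<beta> g (2 *\<^sub>R y n - u n + \<beta> *\<^sub>R dh (y n))"
    and "\<And>n. x (Suc n) = u n + \<kappa> n *\<^sub>R (z n - y n)"
    and "\<And>n. v (Suc n) = (1 - \<alpha> n) *\<^sub>R v n + \<alpha> n *\<^sub>R x n"
  shows "\<exists>p\<in>Gamma_set \<beta> f g dh. weakly_converges x p"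
proof -
  note \<beta> = assms(3)
  note f = assms(4-6) and g = assms(7-9)
  note u = assms(20) and x = assms(23) and v = assms(24)
  obtain q s t where s: "s \<in> subdifferential f q" and t: "t \<in> subdifferential g q"
    and st: "0 = s + t - dh q"
    using assms(13) by (auto simp: stationary_points_def)
  then have q: "q \<in> stationary_points f g dh"
    unfolding stationary_points_def by blast
  \<comment> \<open>The proximal equations are written as inclusions, the form that survives passage
    to the hull.\<close>
  define G where "G = {w. (1 / \<beta>) *\<^sub>R (w - q) \<in> subdifferential f q \<and>
    (1 / \<beta>) *\<^sub>R (2 *\<^sub>R q - w + \<beta> *\<^sub>R dh q - q) \<in> subdifferential g q}"
  have G_Gamma: "G \<subseteq> Gamma_set \<beta> f g dh"
    using q prox_eqI[OF \<beta>, of f] prox_eqI[OF \<beta>, of g] f g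
    unfolding G_def Gamma_set_def by blast
  have "2 *\<^sub>R q - (q + \<beta> *\<^sub>R s) + \<beta> *\<^sub>R dh q - q = \<beta> *\<^sub>R t"
  proof -
    have "dh q = s + t" using st by simp
    then show ?thesis by (simp add: algebra_simps scaleR_2)
  qed
  \<comment> \<open>This witness turns the two inclusions into the given \<open>s\<close> and
    \<open>t\<close>, because \<open>dh q = s + t\<close>.\<close>
  then have "q + \<beta> *\<^sub>R s \<in> G"
    unfolding G_def using s t \<beta> by simp
  then obtain w0 where w0: "w0 \<in> G" by blast

  have y_sub: "(1 / \<beta>) *\<^sub>R (u n - y n) \<in> subdifferential f (y n)" for n
    unfolding assms(21) using \<beta> assms(1) f s by (intro prox_subgradient[where \<rho> = \<rho>]) auto
  have z_sub: "(1 / \<beta>) *\<^sub>R (2 *\<^sub>R y n - u n + \<beta> *\<^sub>R dh (y n) - z n) \<in> subdifferential g (z n)" for n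
    unfolding assms(22)[of n] using \<beta> assms(1) g t
    by (intro prox_subgradient[where \<rho> = \<rho>]) auto
  have unscale: "\<beta> * \<rho> * N \<le> inner (A - B) P"
    if "\<rho> * N \<le> inner ((1 / \<beta>) *\<^sub>R A - (1 / \<beta>) *\<^sub>R B) P" for N and A B P :: 'a
  proof -
    have "inner ((1 / \<beta>) *\<^sub>R A - (1 / \<beta>) *\<^sub>R B) P = inner (A - B) P / \<beta>"
      by (simp add: inner_diff_left diff_divide_distrib)
    with that show ?thesis using \<beta> by (simp add: field_simps)
  qed

  define \<delta> where "\<delta> = \<beta> * (\<rho> - L / 2)"
  have \<delta>: "0 < \<delta>" using \<beta> assms(14) by (simp add: \<delta>_def)
  define R where "R n = (norm (y n - q))\<^sup>2 + (norm (z n - q))\<^sup>2" for n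
  have step: "(norm (x (Suc n) - w))\<^sup>2 + 2 * a * \<delta> * R n \<le> (norm (u n - w))\<^sup>2"
    if w: "w \<in> G" for w n
  proof -
    let ?U = "u n - w" and ?p = "y n - q" and ?q = "z n - q" and ?D = "dh (y n) - dh q"
    have "\<rho> * (norm ?p)\<^sup>2 \<le> inner ((1 / \<beta>) *\<^sub>R (u n - y n) - (1 / \<beta>) *\<^sub>R (w - q)) ?p"
      using w by (intro subdifferential_strongly_monotone[OF f(3,1)] y_sub) (simp add: G_def)
    then have "\<beta> * \<rho> * (norm ?p)\<^sup>2 \<le> inner ((u n - y n) - (w - q)) ?p"
      by (rule unscale)
    also have "(u n - y n) - (w - q) = ?U - ?p" by simp
    finally have fp: "\<beta> * \<rho> * (norm ?p)\<^sup>2 \<le> inner (?U - ?p) ?p" .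
    have "\<rho> * (norm ?q)\<^sup>2 \<le> inner ((1 / \<beta>) *\<^sub>R (2 *\<^sub>R y n - u n + \<beta> *\<^sub>R dh (y n) - z n)
        - (1 / \<beta>) *\<^sub>R (2 *\<^sub>R q - w + \<beta> *\<^sub>R dh q - q)) ?q"
      using w by (intro subdifferential_strongly_monotone[OF g(3,1)] z_sub) (simp add: G_def)
    then have "\<beta> * \<rho> * (norm ?q)\<^sup>2 \<le> inner ((2 *\<^sub>R y n - u n + \<beta> *\<^sub>R dh (y n) - z n)
        - (2 *\<^sub>R q - w + \<beta> *\<^sub>R dh q - q)) ?q"
      by (rule unscale)
    also have "(2 *\<^sub>R y n - u n + \<beta> *\<^sub>R dh (y n) - z n) - (2 *\<^sub>R q - w + \<beta> *\<^sub>R dh q - q)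
        = 2 *\<^sub>R ?p - ?U + \<beta> *\<^sub>R ?D - ?q"
      by (simp add: algebra_simps)
    finally have gq: "\<beta> * \<rho> * (norm ?q)\<^sup>2 \<le> inner (2 *\<^sub>R ?p - ?U + \<beta> *\<^sub>R ?D - ?q) ?q" .
    have "norm ?D \<le> L * norm ?p"
      using lipschitz_onD[OF assms(12), of "y n" q] by (simp add: dist_norm)
    then have "(norm (?q - ?p))\<^sup>2 + \<delta> * R n \<le> - inner ?U (?q - ?p)"
      unfolding \<delta>_def R_def using assms(2) by (intro operator_coercive[OF \<beta> _ fp gq]) auto
    then have "(norm (?U + \<kappa> n *\<^sub>R (?q - ?p)))\<^sup>2 + 2 * a * \<delta> * R n \<le> (norm ?U)\<^sup>2"
      unfolding R_def using \<delta> assms(15,16) assms(17)[of n] by (intro relaxed_step_decrease) auto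
    moreover have "x (Suc n) - w = ?U + \<kappa> n *\<^sub>R (?q - ?p)"
      by (simp add: x)
    ultimately show ?thesis by (simp only:)
  qed

  define E where "E w n = (norm (x n - w))\<^sup>2 + (norm (v n - w))\<^sup>2" for w n
  \<comment> \<open>The weights of \<open>x n\<close> and \<open>v n\<close> in \<open>u n\<close>
    are swapped in \<open>v (Suc n)\<close>, so the two squared distances add up to
    \<open>E w n\<close> minus twice the defect.\<close>
  have decrease: "E w (Suc n) + 2 * (\<alpha> n * (1 - \<alpha> n)) * (norm (v n - x n))\<^sup>2 + 2 * a * \<delta> * R n \<le> E w n"
    if w: "w \<in> G" for w n
  proof -
    have eq: "u n - w = (1 - \<alpha> n) *\<^sub>R (x n - w) + \<alpha> n *\<^sub>R (v n - w)"
      "v (Suc n) - w = (1 - \<alpha> n) *\<^sub>R (v n - w) + \<alpha> n *\<^sub>R (x n - w)"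
      by (simp_all add: u v algebra_simps)
    have "(norm (u n - w))\<^sup>2 = (1 - \<alpha> n) * (norm (x n - w))\<^sup>2 + \<alpha> n * (norm (v n - w))\<^sup>2
        - (1 - \<alpha> n) * \<alpha> n * (norm (v n - x n))\<^sup>2"
      unfolding eq by (subst norm_convex_combination) (simp_all add: norm_minus_commute)
    moreover have "(norm (v (Suc n) - w))\<^sup>2 = (1 - \<alpha> n) * (norm (v n - w))\<^sup>2 + \<alpha> n * (norm (x n - w))\<^sup>2
        - (1 - \<alpha> n) * \<alpha> n * (norm (v n - x n))\<^sup>2"
      unfolding eq by (subst norm_convex_combination) simp_all
    ultimately show ?thesis
      using step[OF w, of n] unfolding E_def by (simp add: algebra_simps)
  qed
  have R_nonneg: "0 \<le> a * \<delta> * R n" for n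
    using assms(15) \<delta> by (simp add: R_def)
  have \<alpha>_nonneg: "0 \<le> (\<alpha> n * (1 - \<alpha> n)) * (norm (v n - x n))\<^sup>2" for n
    using assms(18)[of n] by simp
  have E_dec: "decseq (E w)" if "w \<in> G" for w
  proof (rule decseq_SucI)
    show "E w (Suc n) \<le> E w n" for n
      using decrease[OF that, of n] R_nonneg[of n] \<alpha>_nonneg[of n] by simp
  qed
  have E_conv: "convergent (E w)" if "w \<in> G" for w
    using decseq_convergent[OF E_dec[OF that], of 0] by (auto simp: E_def convergent_def)
  \<comment> \<open>The one-step drop of a convergent sequence tends to zero, and it dominates all
    the nonnegative terms in \<open>decrease\<close>.\<close>
  define d where "d n = E w0 n - E w0 (Suc n)" for n
  obtain e where e: "E w0 \<longlonglongrightarrow> e" using E_conv[OF w0] by (auto simp: convergent_def)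
  have d: "d \<longlonglongrightarrow> 0"
    unfolding d_def using tendsto_diff[OF e LIMSEQ_Suc[OF e]] by simp
  have "0 < 2 * a * \<delta>" using assms(15) \<delta> by simp
  then have R_le: "2 * a * \<delta> * (norm (y n - q))\<^sup>2 \<le> d n" "2 * a * \<delta> * (norm (z n - q))\<^sup>2 \<le> d n" for n
  proof -
    have *: "2 * a * \<delta> * R n \<le> d n"
      using decrease[OF w0, of n] \<alpha>_nonneg[of n] by (simp add: d_def)
    have "2 * a * \<delta> * (norm (y n - q))\<^sup>2 \<le> 2 * a * \<delta> * R n"
      "2 * a * \<delta> * (norm (z n - q))\<^sup>2 \<le> 2 * a * \<delta> * R n"
      using \<open>0 < 2 * a * \<delta>\<close> by (intro mult_left_mono; simp add: R_def)+
    with * show "2 * a * \<delta> * (norm (y n - q))\<^sup>2 \<le> d n" "2 * a * \<delta> * (norm (z n - q))\<^sup>2 \<le> d n"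
      by linarith+
  qed
  have y_lim: "y \<longlonglongrightarrow> q" and z_lim: "z \<longlonglongrightarrow> q"
    using tendsto_zero_of_square_le[OF \<open>0 < 2 * a * \<delta>\<close> R_le(1) d]
      tendsto_zero_of_square_le[OF \<open>0 < 2 * a * \<delta>\<close> R_le(2) d]
    by (simp_all add: LIM_zero_iff)

  \<comment> \<open>Either \<open>\<alpha> n * (1 - \<alpha> n)\<close> has the positive lower bound
    \<open>a' * (1 - b')\<close>, or the averaging is absent; in both cases \<open>u n - x n\<close>
    tends to zero.\<close>
  have alternative: "(\<lambda>n. v n - x n) \<longlonglongrightarrow> 0 \<or> (\<forall>n. \<alpha> n = 0)"
    using assms(19)
  proof (elim disjE exE conjE)
    fix a' b' assume ab': "0 < a'" "b' < 1" "\<forall>n. a' \<le> \<alpha> n \<and> \<alpha> n \<le> b'"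
    have "2 * (a' * (1 - b')) * (norm (v n - x n))\<^sup>2 \<le> d n" for n
    proof -
      have "a' * (1 - b') \<le> \<alpha> n * (1 - \<alpha> n)"
        using ab'(1,2) ab'(3)[rule_format, of n] by (intro mult_mono) auto
      then have "2 * (a' * (1 - b')) * (norm (v n - x n))\<^sup>2 \<le> 2 * (\<alpha> n * (1 - \<alpha> n)) * (norm (v n - x n))\<^sup>2"
        by (intro mult_right_mono) auto
      then show ?thesis
        using decrease[OF w0, of n] R_nonneg[of n] by (simp add: d_def)
    qed
    from tendsto_zero_of_square_le[OF _ this d] have "(\<lambda>n. v n - x n) \<longlonglongrightarrow> 0"
      using ab'(1,2) by simp
    then show ?thesis ..
  qed simp
  have ux: "u n - x n = \<alpha> n *\<^sub>R (v n - x n)" for n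
    by (simp add: u algebra_simps)
  have ux_lim: "(\<lambda>n. u n - x n) \<longlonglongrightarrow> 0"
    using alternative
  proof
    assume vx: "(\<lambda>n. v n - x n) \<longlonglongrightarrow> 0"
    show ?thesis
    proof (rule Lim_null_comparison[OF always_eventually tendsto_norm_zero[OF vx]], intro allI)
      show "norm (u n - x n) \<le> norm (v n - x n)" for n
        unfolding ux using assms(18)[of n] by (simp add: mult_left_le_one_le)
    qed
  qed (simp add: ux)

  have x_bdd: "bounded (range x)"
  proof -
    have "norm (x n - w0) \<le> sqrt (E w0 0)" for n
    proof (rule real_le_rsqrt)
      have "(norm (x n - w0))\<^sup>2 \<le> E w0 n" by (simp add: E_def)
      also have "\<dots> \<le> E w0 0" using decseqD[OF E_dec[OF w0], of 0 n] by simp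
      finally show "(norm (x n - w0))\<^sup>2 \<le> E w0 0" .
    qed
    then have "range x \<subseteq> cball w0 (sqrt (E w0 0))"
      by (auto simp: dist_norm norm_minus_commute)
    then show ?thesis by (rule bounded_subset[OF bounded_cball])
  qed

  \<comment> \<open>In \<open>E p n - E p' n\<close> the quadratic terms in \<open>x n\<close> and
    \<open>v n\<close> cancel, leaving control of \<open>x n + v n\<close>. Then \<open>v n\<close>
    is removed: it is asymptotically equal to \<open>x n\<close> in one case and constant in the
    other.\<close>
  have x_conv: "convergent (\<lambda>n. inner (x n) (p - p'))" if p: "p \<in> G" "p' \<in> G" for p p'
  proof -
    obtain e1 e2 where "E p \<longlonglongrightarrow> e1" "E p' \<longlonglongrightarrow> e2"
      using E_conv[OF p(1)] E_conv[OF p(2)] by (auto simp: convergent_def)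
    then have "(\<lambda>n. (norm p)\<^sup>2 - (norm p')\<^sup>2 - (E p n - E p' n) / 2)
        \<longlonglongrightarrow> (norm p)\<^sup>2 - (norm p')\<^sup>2 - (e1 - e2) / 2"
      by (intro tendsto_intros) simp_all
    moreover have "inner (x n + v n) (p - p') = (norm p)\<^sup>2 - (norm p')\<^sup>2 - (E p n - E p' n) / 2" for n
      by (simp add: E_def power2_norm_eq_inner algebra_simps inner_commute add_divide_distrib
          diff_divide_distrib)
    ultimately have sum: "convergent (\<lambda>n. inner (x n + v n) (p - p'))"
      by (auto simp: convergent_def)
    show ?thesis
      using alternative
    proof
      assume "(\<lambda>n. v n - x n) \<longlonglongrightarrow> 0"
      moreover obtain l where "(\<lambda>n. inner (x n + v n) (p - p')) \<longlonglongrightarrow> l"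
        using sum by (auto simp: convergent_def)
      ultimately have "(\<lambda>n. (inner (x n + v n) (p - p') - inner (v n - x n) (p - p')) / 2)
          \<longlonglongrightarrow> (l - inner 0 (p - p')) / 2"
        by (intro tendsto_intros) auto
      moreover have "(inner (x n + v n) (p - p') - inner (v n - x n) (p - p')) / 2
          = inner (x n) (p - p')" for n
        by (simp add: inner_add_left inner_diff_left)
      ultimately show ?thesis by (auto simp: convergent_def)
    next
      assume "\<forall>n. \<alpha> n = 0"
      then have "v n = v 0" for n by (induction n) (simp_all add: v)
      then have "inner (x n) (p - p') = inner (x n + v n) (p - p') - inner (v 0) (p - p')" for n
        by (metis add_diff_cancel_right' inner_add_left)
      moreover have "convergent (\<lambda>n. inner (x n + v n) (p - p') - inner (v 0) (p - p'))"
        using sum by (intro convergent_diff convergent_const)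
      ultimately show ?thesis by simp
    qed
  qed

  have dh_lim: "(\<lambda>n. dh (y n)) \<longlonglongrightarrow> dh q"
    using continuous_on_tendsto_compose[OF lipschitz_on_continuous_on[OF assms(12)] y_lim] by simp
  have hull: "asymptotic_hull (x \<circ> r) \<subseteq> G" if r: "strict_mono r" for r
  proof
    fix c assume c: "c \<in> asymptotic_hull (x \<circ> r)"
    note sub = LIMSEQ_subseq_LIMSEQ[OF _ r, unfolded o_def]
    have bdd: "bounded (range (x \<circ> r))"
      using x_bdd by (rule bounded_subset) auto
    \<comment> \<open>The \<open>0\<close> stands for the limit of \<open>u n - x n\<close>, by
      which \<open>u n\<close> is replaced with \<open>x n\<close>.\<close>
    have "(1 / \<beta>) *\<^sub>R c + (1 / \<beta>) *\<^sub>R (0 - q) \<in> subdifferential f q"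
    proof (rule subdifferential_affine_hull_limit[OF f(1,2) sub[OF y_lim] y_sub bdd c])
      have "(\<lambda>n. (1 / \<beta>) *\<^sub>R ((u (r n) - x (r n)) - y (r n))) \<longlonglongrightarrow> (1 / \<beta>) *\<^sub>R (0 - q)"
        by (intro tendsto_intros sub[OF y_lim] sub[OF ux_lim])
      then show "(\<lambda>n. (1 / \<beta>) *\<^sub>R (u (r n) - y (r n)) - (1 / \<beta>) *\<^sub>R (x \<circ> r) n)
          \<longlonglongrightarrow> (1 / \<beta>) *\<^sub>R (0 - q)"
        by (simp add: algebra_simps)
    qed
    \<comment> \<open>Here \<open>u n\<close> enters the reflected argument with a minus sign, hence
      the factor \<open>- 1 / \<beta>\<close>.\<close>
    moreover have "(- 1 / \<beta>) *\<^sub>R c + (1 / \<beta>) *\<^sub>R (2 *\<^sub>R q - 0 + \<beta> *\<^sub>R dh q - q) \<in> subdifferential g q"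
    proof (rule subdifferential_affine_hull_limit[OF g(1,2) sub[OF z_lim] z_sub bdd c])
      have "(\<lambda>n. (1 / \<beta>) *\<^sub>R (2 *\<^sub>R y (r n) - (u (r n) - x (r n)) + \<beta> *\<^sub>R dh (y (r n)) - z (r n)))
          \<longlonglongrightarrow> (1 / \<beta>) *\<^sub>R (2 *\<^sub>R q - 0 + \<beta> *\<^sub>R dh q - q)"
        by (intro tendsto_intros sub[OF y_lim] sub[OF z_lim] sub[OF ux_lim] sub[OF dh_lim])
      then show "(\<lambda>n. (1 / \<beta>) *\<^sub>R (2 *\<^sub>R y (r n) - u (r n) + \<beta> *\<^sub>R dh (y (r n)) - z (r n))
          - (- 1 / \<beta>) *\<^sub>R (x \<circ> r) n) \<longlonglongrightarrow> (1 / \<beta>) *\<^sub>R (2 *\<^sub>R q - 0 + \<beta> *\<^sub>R dh q - q)"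
        by (simp add: algebra_simps)
    qed
    ultimately show "c \<in> G"
      unfolding G_def by (simp add: algebra_simps)
  qed
  obtain p where "p \<in> G" "weakly_converges x p"
    using weakly_converges_asymptotic_hull[OF x_bdd hull x_conv] by blast
  then show ?thesis using G_Gamma by blast
qed

end
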